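(* Standard MergeSort with linear merging, run on an input whose order is a uniformly random permutation, has fragile complexity $O(\log n)$ with high probability: there is a constant $C$ such that, with probability at least $1-1/n$, every element participates in at most $C\log n$ comparisons.
   Context: Standard MergeSort divides the $n$ input elements (from a totally ordered set) into two sets of sizes $\lceil n/2\rceil$ and $\lfloor n/2\rfloor$ (by position), recursively sorts these, and merges the two sorted sequences. Linear merging is the classical sequential merge: repeatedly compare the first remaining elements of the two sequences and move the smaller one to the output. "With high probability" means with probability at least $1-1/n$. *)

theory Defs
  imports "HOL-Probability.Probability" "HOL-Combinatorics.Multiset_Permutations"
begin

text \<open>Both algorithms return their output together with the list of all comparisons
  they perform, in order of execution; each comparison is the pair of elements compared.\<close>

fun linear_merge :: "'a::linorder list \<Rightarrow> 'a list \<Rightarrow> 'a list \<times> ('a \<times> 'a) list" where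
  "linear_merge [] ys = (ys, [])"
| "linear_merge xs [] = (xs, [])"
| "linear_merge (x # xs) (y # ys) =
     (if x \<le> y
      then let (zs, cs) = linear_merge xs (y # ys) in (x # zs, (x, y) # cs)
      else let (zs, cs) = linear_merge (x # xs) ys in (y # zs, (x, y) # cs))"

function merge_sort :: "'a::linorder list \<Rightarrow> 'a list \<times> ('a \<times> 'a) list" where
  "merge_sort xs =
     (if length xs \<le> 1 then (xs, [])
      else let m = (length xs + 1) div 2; \<comment> \<open>the ceiling of half the length\<close>
               (us, cs) = merge_sort (take m xs);
               (vs, ds) = merge_sort (drop m xs);
               (zs, es) = linear_merge us vs
           in (zs, cs @ ds @ es))"
  by auto
termination
  by (relation "Wellfounded.measure length") auto

declare merge_sort.simps [simp del]

definition num_comparisons :: "'a::linorder list \<Rightarrow> 'a \<Rightarrow> nat" where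
  "num_comparisons xs x = length (filter (\<lambda>(a, b). a = x \<or> b = x) (snd (merge_sort xs)))"

lemma mset_linear_merge: "mset (fst (linear_merge xs ys)) = mset xs + mset ys"
  by (induction xs ys rule: linear_merge.induct) (auto simp: split_beta)

lemma set_linear_merge: "set (fst (linear_merge xs ys)) = set xs \<union> set ys"
  by (metis mset_linear_merge set_mset_mset set_mset_union)

lemma sorted_linear_merge:
  "sorted xs \<Longrightarrow> sorted ys \<Longrightarrow> sorted (fst (linear_merge xs ys))"
  by (induction xs ys rule: linear_merge.induct)
     (auto simp: split_beta set_linear_merge dest: order_trans)

lemma merge_sort_sorts:
  "mset (fst (merge_sort xs)) = mset xs \<and> sorted (fst (merge_sort xs))"
proof (induction xs rule: length_induct)
  case (1 xs)
  show ?case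
  proof (cases "length xs \<le> 1")
    case True
    then show ?thesis
      by (subst (1 2) merge_sort.simps) (simp add: sorted01)
  next
    case False
    define m where "m = (length xs + 1) div 2"
    have "length (take m xs) < length xs" "length (drop m xs) < length xs"
      using False by (auto simp: m_def)
    then have IH:
      "mset (fst (merge_sort (take m xs))) = mset (take m xs)"
      "sorted (fst (merge_sort (take m xs)))"
      "mset (fst (merge_sort (drop m xs))) = mset (drop m xs)"
      "sorted (fst (merge_sort (drop m xs)))"
      using 1 by blast+
    have split: "mset (take m xs) + mset (drop m xs) = mset xs"
      by (metis append_take_drop_id mset_append)
    have "fst (merge_sort xs) =
        fst (linear_merge (fst (merge_sort (take m xs))) (fst (merge_sort (drop m xs))))"
      using False by (subst merge_sort.simps) (simp add: split_beta Let_def m_def)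
    then show ?thesis
      using IH split by (simp add: mset_linear_merge sorted_linear_merge)
  qed
qed

lemma merge_sort_correct: "fst (merge_sort xs) = sort xs"
  by (metis merge_sort_sorts properties_for_sort)

end

theory Submission
  imports Defs
begin

text \<open>In a merge, an element \<open>x\<close> takes part in at most \<open>1 + K\<close> comparisons, where \<open>K\<close> is the
  number of elements of the other run between \<open>x\<close> and its predecessor in its own run. The set of
  elements in the left run is a uniformly random subset of the block being sorted, so \<open>K \<ge> j\<close> forces
  the \<open>j\<close> elements just below \<open>x\<close> into the other run, which has probability at most \<open>2 (3/4)^j\<close>.
  Given this subset, both recursive calls are again on uniformly random permutations; hence every
  level multiplies the expectation of \<open>(5/4)^num_comparisons\<close> by at most
  \<open>(5/4) \<cdot> 2 \<cdot> \<Sum>\<^sub>j (15/16)^j = 40\<close>, and that expectation is at most \<open>40^d\<close> for at most \<open>2^d\<close> elements.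
  Markov's inequality makes each element bad with probability at most \<open>1/n^2\<close>, and a union
  bound concludes.\<close>

section \<open>Comparisons of one element within a single merge\<close>

text \<open>The count inside \<open>num_comparisons\<close>, taken over an arbitrary list of
  comparisons so that single merges can be counted and concatenations split.\<close>

definition participations :: "('a \<times> 'a) list \<Rightarrow> 'a \<Rightarrow> nat" where
  "participations cs x = length (filter (\<lambda>(a, b). a = x \<or> b = x) cs)"

lemma participations_simps [simp]:
  "participations [] x = 0"
  "participations ((a, b) # cs) x = (if a = x \<or> b = x then Suc (participations cs x) else participations cs x)"
  "participations (cs @ ds) x = participations cs x + participations ds x"
  by (auto simp: participations_def)

lemma participations_swap: "participations (map prod.swap cs) x = participations cs x"
  by (induction cs) (auto simp: participations_def)

lemma participations_eq_0: "set cs \<subseteq> B \<times> B \<Longrightarrow> x \<notin> B \<Longrightarrow> participations cs x = 0"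
  by (induction cs) (auto simp: participations_def)

text \<open>For \<open>x\<close> in the run \<open>S\<close>, these are the elements of
  \<open>T\<close> between \<open>x\<close> and its predecessor in \<open>S\<close>; without a
  predecessor, all elements of \<open>T\<close> below \<open>x\<close>.\<close>

definition gap :: "'a::linorder set \<Rightarrow> 'a set \<Rightarrow> 'a \<Rightarrow> 'a set" where
  "gap S T x = {y \<in> T. y < x \<and> (\<forall>u\<in>S. u < x \<longrightarrow> u < y)}"

lemma finite_gap [simp]: "finite T \<Longrightarrow> finite (gap S T x)"
  by (simp add: gap_def)

lemma linear_merge_Nil2 [simp]: "linear_merge xs [] = (xs, [])"
  by (cases xs) auto

text \<open>Disjointness rules out ties, the only case in which the merge favours one argument. This
  lets the bound for the left run carry over to the right run.\<close>

lemma linear_merge_commute: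
  "set xs \<inter> set ys = {} \<Longrightarrow>
    linear_merge ys xs = (fst (linear_merge xs ys), map prod.swap (snd (linear_merge xs ys)))"
  by (induction xs ys rule: linear_merge.induct) (auto simp: split_beta Let_def)

lemma set_snd_linear_merge: "set (snd (linear_merge xs ys)) \<subseteq> set xs \<times> set ys"
  by (induction xs ys rule: linear_merge.induct) (auto simp: split_beta Let_def)

text \<open>\<open>x\<close> is compared only while it heads its run. By then every element of
  \<open>ys\<close> below its predecessor is gone, so each comparison outputs either an element of
  the gap or, at most once, \<open>x\<close> itself.\<close>

lemma participations_linear_merge_left:
  assumes "sorted xs" "sorted ys" "distinct xs" "distinct ys" "set xs \<inter> set ys = {}" "x \<in> set xs"
  shows "participations (snd (linear_merge xs ys)) x \<le> Suc (card (gap (set xs) (set ys) x))"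
  using assms
proof (induction xs ys rule: linear_merge.induct)
  case (3 a xs b ys)
  have ne: "x \<noteq> b" using 3 by auto
  show ?case
  proof (cases "a \<le> b")
    case True
    show ?thesis
    proof (cases "x = a")
      case xa: True
      have "participations (snd (linear_merge xs (b # ys))) x = 0"
        using set_snd_linear_merge[of xs "b # ys"] 3(3-) xa
        by (intro participations_eq_0[where B = "set xs \<union> set (b # ys)"]) auto
      then show ?thesis using True xa by (simp add: split_beta Let_def)
    next
      case xa: False
      \<comment> \<open>Everything left in the other run exceeds \<open>a\<close>, so dropping
        \<open>a\<close> removes a constraint that every candidate already meets.\<close>
      have "\<forall>y\<in>set (b # ys). a < y"
        using 3(3-) True by (auto simp: less_le)
      then have "gap (set (a # xs)) (set (b # ys)) x = gap (set xs) (set (b # ys)) x"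
        by (auto simp: gap_def)
      then show ?thesis using 3(1)[OF True] 3(3-) True xa ne by (simp add: split_beta Let_def)
    qed
  next
    case False
    have IH: "participations (snd (linear_merge (a # xs) ys)) x \<le> Suc (card (gap (set (a # xs)) (set ys) x))"
      using 3(2)[OF False] 3(3-) by auto
    show ?thesis
    proof (cases "x = a")
      case xa: True
      \<comment> \<open>Nothing in the run of \<open>x\<close> lies below its head \<open>x\<close>,
        so \<open>b\<close> belongs to the gap and pays for the comparison just made.\<close>
      have "gap (set (a # xs)) (set (b # ys)) x = insert b (gap (set (a # xs)) (set ys) x)"
        using 3(3-) False xa by (auto simp: gap_def)
      moreover have "b \<notin> gap (set (a # xs)) (set ys) x"
        using 3(3-) by (auto simp: gap_def)
      ultimately show ?thesis using IH False xa by (simp add: split_beta Let_def)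
    next
      case xa: False
      have "card (gap (set (a # xs)) (set ys) x) \<le> card (gap (set (a # xs)) (set (b # ys)) x)"
        by (rule card_mono) (auto simp: gap_def)
      then show ?thesis using IH False xa ne by (simp add: split_beta Let_def)
    qed
  qed
qed auto

lemma participations_linear_merge_right:
  assumes "sorted xs" "sorted ys" "distinct xs" "distinct ys" "set xs \<inter> set ys = {}" "x \<in> set ys"
  shows "participations (snd (linear_merge xs ys)) x \<le> Suc (card (gap (set ys) (set xs) x))"
proof -
  have "participations (snd (linear_merge ys xs)) x = participations (snd (linear_merge xs ys)) x"
    using linear_merge_commute[of xs ys] assms by (simp add: participations_swap)
  moreover have "participations (snd (linear_merge ys xs)) x \<le> Suc (card (gap (set ys) (set xs) x))"
    using assms by (intro participations_linear_merge_left) auto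
  ultimately show ?thesis by simp
qed

section \<open>From one merge to the recursion\<close>

lemma snd_merge_sort_short: "length xs \<le> 1 \<Longrightarrow> snd (merge_sort xs) = []"
  by (subst merge_sort.simps) simp

lemma snd_merge_sort:
  assumes "length us = (length (us @ vs) + 1) div 2" "length (us @ vs) > 1"
  shows "snd (merge_sort (us @ vs)) =
    snd (merge_sort us) @ snd (merge_sort vs) @ snd (linear_merge (sort us) (sort vs))"
  using assms by (subst merge_sort.simps)
    (simp add: split_beta Let_def merge_sort_correct flip: assms(1))

lemma set_snd_merge_sort: "set (snd (merge_sort xs)) \<subseteq> set xs \<times> set xs"
proof (induction xs rule: length_induct)
  case (1 xs)
  show ?case
  proof (cases "length xs \<le> 1")
    case True
    then show ?thesis by (simp add: snd_merge_sort_short)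
  next
    case False
    define us vs where "us = take ((length xs + 1) div 2) xs" and "vs = drop ((length xs + 1) div 2) xs"
    have xs: "xs = us @ vs" by (simp add: us_def vs_def)
    have len: "length us = (length (us @ vs) + 1) div 2" "length (us @ vs) > 1"
      using False by (simp_all add: us_def vs_def)
    have "length us < length xs" "length vs < length xs"
      using False by (auto simp: us_def vs_def)
    then have "set (snd (merge_sort us)) \<subseteq> set us \<times> set us" "set (snd (merge_sort vs)) \<subseteq> set vs \<times> set vs"
      using 1 by blast+
    then show ?thesis
      using set_snd_linear_merge[of "sort us" "sort vs"]
      unfolding xs snd_merge_sort[OF len] by auto
  qed
qed

lemma num_comparisons_eq: "num_comparisons xs x = participations (snd (merge_sort xs)) x"
  by (simp add: num_comparisons_def participations_def)

lemma num_comparisons_eq_0: "x \<notin> set xs \<Longrightarrow> num_comparisons xs x = 0"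
  unfolding num_comparisons_eq by (rule participations_eq_0[OF set_snd_merge_sort])

text \<open>\<open>x\<close> lies in one half only, so sorting the other half never touches it, and
  the final merge adds at most one more than the gap.\<close>

lemma num_comparisons_append:
  assumes "length us = (length (us @ vs) + 1) div 2" "length (us @ vs) > 1" "distinct (us @ vs)"
  shows "x \<in> set us \<Longrightarrow> num_comparisons (us @ vs) x \<le> num_comparisons us x + Suc (card (gap (set us) (set vs) x))"
    and "x \<in> set vs \<Longrightarrow> num_comparisons (us @ vs) x \<le> num_comparisons vs x + Suc (card (gap (set vs) (set us) x))"
proof -
  have eq: "num_comparisons (us @ vs) x = num_comparisons us x + num_comparisons vs x
      + participations (snd (linear_merge (sort us) (sort vs))) x"
    unfolding num_comparisons_eq snd_merge_sort[OF assms(1,2)] by simp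
  show "num_comparisons (us @ vs) x \<le> num_comparisons us x + Suc (card (gap (set us) (set vs) x))"
    if "x \<in> set us"
  proof -
    have "x \<notin> set vs" using that assms(3) by auto
    then show ?thesis
      using participations_linear_merge_left[of "sort us" "sort vs" x] that assms(3)
      by (simp add: eq num_comparisons_eq_0)
  qed
  show "num_comparisons (us @ vs) x \<le> num_comparisons vs x + Suc (card (gap (set vs) (set us) x))"
    if "x \<in> set vs"
  proof -
    have "x \<notin> set us" using that assms(3) by auto
    then show ?thesis
      using participations_linear_merge_right[of "sort us" "sort vs" x] that assms(3)
      by (simp add: eq num_comparisons_eq_0)
  qed
qed

section \<open>Counting the splits that leave a long gap\<close>

text \<open>Supplies the \<open>j\<close> elements directly below a given one; they are collected by
  adjoining the maximum of the remainder \<open>j\<close> times.\<close>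

lemma ex_upper_subset:
  fixes B :: "'a::linorder set"
  assumes "finite B" "j \<le> card B"
  shows "\<exists>P\<subseteq>B. card P = j \<and> (\<forall>p\<in>P. \<forall>y\<in>B. p < y \<longrightarrow> y \<in> P)"
  using assms(2)
proof (induction j)
  case 0
  then show ?case by (intro exI[of _ "{}"]) auto
next
  case (Suc j)
  then obtain P where P: "P \<subseteq> B" "card P = j" "\<forall>p\<in>P. \<forall>y\<in>B. p < y \<longrightarrow> y \<in> P"
    by auto
  have fin: "finite P" using P(1) assms(1) finite_subset by blast
  have "B - P \<noteq> {}" using P Suc.prems by auto
  then have M: "Max (B - P) \<in> B - P" "\<forall>y\<in>B - P. y \<le> Max (B - P)"
    using assms(1) by (auto intro: Max_in simp del: Diff_iff)
  show ?case
  proof (intro exI[of _ "insert (Max (B - P)) P"] conjI ballI impI)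
    show "card (insert (Max (B - P)) P) = Suc j" using M fin P by simp
    show "insert (Max (B - P)) P \<subseteq> B" using M P by auto
    fix p y assume "p \<in> insert (Max (B - P)) P" "y \<in> B" "p < y"
    then show "y \<in> insert (Max (B - P)) P" using M P(3)
      by (metis DiffI insert_iff leD)
  qed
qed

text \<open>Let \<open>P\<close> be the \<open>j\<close> elements just below \<open>x\<close>. If
  \<open>S\<close> contained some \<open>p\<close> in \<open>P\<close>, the gap would lie inside
  \<open>P - {p}\<close> and be too small. So \<open>S - {x}\<close> is an
  \<open>(m - 1)\<close>-element subset of what remains without \<open>x\<close> and
  \<open>P\<close>.\<close>

lemma card_gap_ge:
  fixes A :: "'a::linorder set"
  assumes "finite A" "x \<in> A" "1 \<le> m"
  shows "card {S. S \<subseteq> A \<and> card S = m \<and> x \<in> S \<and> j \<le> card (gap S (A - S) x)}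
    \<le> (card A - 1 - j) choose (m - 1)"
proof (cases "j \<le> card {y\<in>A. y < x}")
  \<comment> \<open>With fewer than \<open>j\<close> elements below \<open>x\<close>, no gap reaches
    size \<open>j\<close>.\<close>
  case False
  have "\<not> j \<le> card (gap S (A - S) x)" for S
  proof -
    have "card (gap S (A - S) x) \<le> card {y\<in>A. y < x}"
      by (rule card_mono) (use assms in \<open>auto simp: gap_def\<close>)
    then show ?thesis using False by simp
  qed
  then show ?thesis by simp
next
  case True
  from ex_upper_subset[OF _ True] obtain P where
    P: "P \<subseteq> {y\<in>A. y < x}" "card P = j" and up: "\<forall>p\<in>P. \<forall>y\<in>{y\<in>A. y < x}. p < y \<longrightarrow> y \<in> P"
    using assms(1) by auto
  have finP: "finite P" using P(1) assms(1) by (auto intro: finite_subset)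
  let ?R = "A - insert x P"
  have "card ?R = card A - Suc j"
    using P assms finP by (subst card_Diff_subset) (auto simp: card_insert_if)
  then have cardR: "card ?R = card A - 1 - j" by simp
  have avoid: "S \<inter> P = {}" if "j \<le> card (gap S (A - S) x)" for S
  proof (rule ccontr)
    assume "S \<inter> P \<noteq> {}"
    then obtain p where p: "p \<in> S" "p \<in> P" by auto
    have "gap S (A - S) x \<subseteq> P - {p}"
      using p P(1) up by (auto simp: gap_def)
    then have "card (gap S (A - S) x) \<le> card (P - {p})"
      using finP by (intro card_mono) auto
    also have "\<dots> < j" using p P(2) finP by (metis card_Diff1_less)
    finally show False using that by simp
  qed
  have "{S. S \<subseteq> A \<and> card S = m \<and> x \<in> S \<and> j \<le> card (gap S (A - S) x)}
      \<subseteq> insert x ` {U. U \<subseteq> ?R \<and> card U = m - 1}"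
  proof clarify
    fix S assume S: "S \<subseteq> A" "m = card S" "x \<in> S" "j \<le> card (gap S (A - S) x)"
    show "S \<in> insert x ` {U. U \<subseteq> ?R \<and> card U = card S - 1}"
      using S avoid[OF S(4)] by (intro image_eqI[of _ _ "S - {x}"]) (auto simp: insert_absorb)
  qed
  then have "card {S. S \<subseteq> A \<and> card S = m \<and> x \<in> S \<and> j \<le> card (gap S (A - S) x)}
      \<le> card (insert x ` {U. U \<subseteq> ?R \<and> card U = m - 1})"
    using assms(1) by (intro card_mono) auto
  also have "\<dots> \<le> card {U. U \<subseteq> ?R \<and> card U = m - 1}"
    using assms(1) by (intro card_image_le) auto
  also have "\<dots> = card ?R choose (m - 1)"
    using assms(1) by (intro n_subsets) auto
  finally show ?thesis unfolding cardR .
qed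

text \<open>Lowering the upper index from \<open>L\<close> to \<open>L - 1\<close> multiplies the
  coefficient by \<open>(L - M) / L\<close>, which is at most \<open>3/4\<close> as long as
  \<open>L \<le> 4 * M\<close>.\<close>

lemma binomial_diff_le:
  assumes "N \<le> 4 * M" "j \<le> N"
  shows "real ((N - j) choose M) \<le> (3/4) ^ j * real (N choose M)"
  using assms(2)
proof (induction j)
  case (Suc j)
  define L where "L = N - j"
  have L: "L > 0" "N - Suc j = L - 1" "L \<le> 4 * M" using Suc.prems assms(1) by (auto simp: L_def)
  have "real L * real ((L - 1) choose M) = real (L - M) * real (L choose M)"
    using binomial_absorb_comp[of L M] by (metis of_nat_mult)
  also have "\<dots> \<le> (3/4 * real L) * real (L choose M)"
    using L by (intro mult_right_mono) linarith+
  finally have "real ((L - 1) choose M) \<le> 3/4 * real (L choose M)"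
    using L(1) by (simp add: mult.assoc mult.left_commute)
  also have "\<dots> \<le> 3/4 * ((3/4) ^ j * real (N choose M))"
    using Suc by (simp add: L_def)
  finally show ?case by (simp add: L(2))
qed simp

text \<open>For \<open>n \<ge> 4\<close> the ratio bound applies, since
  \<open>n - 1 \<le> 4 * (m - 1)\<close>. The factor 2 covers smaller \<open>n\<close>: there
  \<open>j \<le> 2\<close>, and \<open>2 * (3/4)^2 = 9/8\<close> is still at least 1.\<close>

lemma binomial_half_diff_le:
  assumes "m = n div 2 \<or> m = (n + 1) div 2" "1 \<le> m" "j < n"
  shows "real ((n - 1 - j) choose (m - 1)) \<le> 2 * (3/4) ^ j * real ((n - 1) choose (m - 1))"
proof (cases "n \<ge> 4")
  case True
  have "n div 2 \<ge> 2" "n \<le> 2 * (n div 2) + 1" "m \<ge> n div 2"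
    using assms(1) div_le_mono[OF True, of 2] by (auto intro: div_le_mono)
  then have "n - 1 \<le> 4 * (m - 1)" by linarith
  then have "real ((n - 1 - j) choose (m - 1)) \<le> (3/4) ^ j * real ((n - 1) choose (m - 1))"
    using assms(3) by (intro binomial_diff_le) auto
  also have "\<dots> \<le> 2 * ((3/4) ^ j * real ((n - 1) choose (m - 1)))" by simp
  finally show ?thesis by simp
next
  case False
  have j: "j = 0 \<or> j = 1 \<or> j = 2" using False assms by auto
  have "real ((n - 1 - j) choose (m - 1)) \<le> 1 * real ((n - 1) choose (m - 1))"
    by (simp add: binomial_right_mono)
  also have "\<dots> \<le> (2 * (3/4) ^ j) * real ((n - 1) choose (m - 1))"
    by (rule mult_right_mono) (use j in \<open>auto simp: power2_eq_square\<close>)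
  finally show ?thesis .
qed

lemma sum_power_gap:
  fixes A :: "'a::linorder set"
  assumes "finite A" "x \<in> A" "1 \<le> m" "m = card A div 2 \<or> m = (card A + 1) div 2"
  shows "(\<Sum>S | S \<subseteq> A \<and> card S = m \<and> x \<in> S. (5/4 :: real) ^ Suc (card (gap S (A - S) x)))
    \<le> 40 * real ((card A - 1) choose (m - 1))"
proof -
  let ?F = "{S. S \<subseteq> A \<and> card S = m \<and> x \<in> S}"
  let ?k = "\<lambda>S. card (gap S (A - S) x)"
  let ?n = "card A" and ?b = "real ((card A - 1) choose (m - 1))"
  have fin: "finite ?F" using assms(1) by auto
  have klt: "?k S < ?n" for S
    using assms(1,2) by (intro psubset_card_mono) (auto simp: gap_def)
  \<comment> \<open>A power is at most the sum of all powers up to it, which reduces the sum to tail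
    counts. The range \<open>j < ?n\<close> suffices since \<open>x\<close> is not in its own
    gap.\<close>
  have "(\<Sum>S\<in>?F. (5/4 :: real) ^ ?k S) \<le> (\<Sum>S\<in>?F. \<Sum>j<?n. if j \<le> ?k S then (5/4) ^ j else 0)"
  proof (rule sum_mono)
    fix S
    have "(\<Sum>j\<in>{?k S}. if j \<le> ?k S then (5/4 :: real) ^ j else 0) \<le> (\<Sum>j<?n. if j \<le> ?k S then (5/4) ^ j else 0)"
      by (rule sum_mono2) (use klt in auto)
    then show "(5/4 :: real) ^ ?k S \<le> (\<Sum>j<?n. if j \<le> ?k S then (5/4) ^ j else 0)" by simp
  qed
  also have "\<dots> = (\<Sum>j<?n. \<Sum>S\<in>?F. if j \<le> ?k S then (5/4) ^ j else 0)"
    by (rule sum.swap)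
  also have "\<dots> = (\<Sum>j<?n. (5/4) ^ j * real (card {S. S \<subseteq> A \<and> card S = m \<and> x \<in> S \<and> j \<le> ?k S}))"
  proof (rule sum.cong)
    fix j
    have "{S \<in> ?F. j \<le> ?k S} = {S. S \<subseteq> A \<and> card S = m \<and> x \<in> S \<and> j \<le> ?k S}" by auto
    then show "(\<Sum>S\<in>?F. if j \<le> ?k S then (5/4 :: real) ^ j else 0)
        = (5/4) ^ j * real (card {S. S \<subseteq> A \<and> card S = m \<and> x \<in> S \<and> j \<le> ?k S})"
      using fin by (subst sum.inter_filter[symmetric]) (simp_all add: mult.commute)
  qed simp
  also have "\<dots> \<le> (\<Sum>j<?n. (5/4) ^ j * (2 * (3/4) ^ j * ?b))"
  proof (intro sum_mono mult_left_mono)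
    fix j assume "j \<in> {..<?n}"
    then show "real (card {S. S \<subseteq> A \<and> card S = m \<and> x \<in> S \<and> j \<le> ?k S}) \<le> 2 * (3/4) ^ j * ?b"
      using card_gap_ge[OF assms(1-3), of j] binomial_half_diff_le[OF assms(4,3), of j] by simp
  qed simp
  also have "\<dots> = (\<Sum>j<?n. 2 * ?b * (5/4 * (3/4)) ^ j)"
    by (intro sum.cong refl) (simp only: power_mult_distrib mult_ac)
  also have "\<dots> = 2 * ?b * (\<Sum>j<?n. (15/16) ^ j)"
    by (simp add: sum_distrib_left)
  \<comment> \<open>Partial sums of the geometric series with ratio \<open>15/16\<close> stay below
    16; the \<open>Suc\<close> in the exponent contributes the remaining \<open>5/4\<close>.\<close>
  also have "\<dots> \<le> 2 * ?b * 16"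
    by (intro mult_left_mono) (simp_all add: sum_gp_strict)
  finally show ?thesis
    unfolding power_Suc sum_distrib_left[symmetric] by linarith
qed

section \<open>Exponential moment over random permutations\<close>

text \<open>A permutation is determined by the set of its first \<open>m\<close> entries and the
  orders of the two parts. Hence, given that set, the halves are independent and uniform.\<close>

lemma sum_permutations_split:
  fixes A :: "'a set"
  assumes "finite A" "m \<le> card A"
  shows "(\<Sum>xs\<in>permutations_of_set A. f xs) =
    (\<Sum>S | S \<subseteq> A \<and> card S = m.
      \<Sum>us\<in>permutations_of_set S. \<Sum>vs\<in>permutations_of_set (A - S). f (us @ vs))"
proof -
  let ?P = "permutations_of_set"
  have in_drop: "y \<in> set (drop m b)" if "y \<in> set b" "y \<notin> set (take m b)" for b :: "'a list" and y
    using that by (metis UnE append_take_drop_id set_append)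
  have "(\<Sum>S | S \<subseteq> A \<and> card S = m. \<Sum>us\<in>?P S. \<Sum>vs\<in>?P (A - S). f (us @ vs)) =
      (\<Sum>S | S \<subseteq> A \<and> card S = m. \<Sum>(us, vs)\<in>?P S \<times> ?P (A - S). f (us @ vs))"
    by (simp add: sum.cartesian_product)
  also have "\<dots> = (\<Sum>(S, us, vs)\<in>(SIGMA S:{S. S \<subseteq> A \<and> card S = m}. ?P S \<times> ?P (A - S)). f (us @ vs))"
    using assms(1) by (subst sum.Sigma) auto
  also have "\<dots> = (\<Sum>xs\<in>?P A. f xs)"
    by (rule sum.reindex_bij_witness[where
          i = "\<lambda>xs. (set (take m xs), take m xs, drop m xs)" and j = "\<lambda>(S, us, vs). us @ vs"])
      (use assms in \<open>auto simp: permutations_of_set_def distinct_card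
         intro: in_drop dest: in_set_takeD in_set_dropD set_take_disj_set_drop_if_distinct\<close>)
  finally show ?thesis by simp
qed

text \<open>When \<open>x\<close> is in the right half, the complement becomes the block of
  \<open>x\<close>, so one gap estimate serves both halves.\<close>

lemma sum_complements:
  assumes "finite A" "m \<le> card A"
  shows "(\<Sum>S | S \<subseteq> A \<and> card S = m \<and> x \<in> A - S. g (A - S)) =
    (\<Sum>S | S \<subseteq> A \<and> card S = card A - m \<and> x \<in> S. g S)"
proof (rule sum.reindex_bij_witness[where i = "\<lambda>S. A - S" and j = "\<lambda>S. A - S"])
  show "A - S \<in> {S. S \<subseteq> A \<and> card S = card A - m \<and> x \<in> S}"
    if "S \<in> {S. S \<subseteq> A \<and> card S = m \<and> x \<in> A - S}" for S
    using that assms by (auto simp: card_Diff_subset finite_subset)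
  show "A - S \<in> {S. S \<subseteq> A \<and> card S = m \<and> x \<in> A - S}"
    if "S \<in> {S. S \<subseteq> A \<and> card S = card A - m \<and> x \<in> S}" for S
    using that assms by (auto simp: card_Diff_subset finite_subset)
qed auto

text \<open>An expectation before division by \<open>fact (card A)\<close>. Induction on
  \<open>d\<close> fits the recursion, as half of at most \<open>2 ^ Suc d\<close> elements, even
  rounded up, is at most \<open>2 ^ d\<close>.\<close>

lemma sum_power_num_comparisons:
  fixes A :: "'a::linorder set"
  assumes "finite A" "x \<in> A" "card A \<le> 2 ^ d"
  shows "(\<Sum>xs\<in>permutations_of_set A. (5/4 :: real) ^ num_comparisons xs x) \<le> 40 ^ d * fact (card A)"
  using assms
proof (induction d arbitrary: A)
  case (0 A)
  then have "num_comparisons xs x = 0" if "xs \<in> permutations_of_set A" for xs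
    using that by (simp add: num_comparisons_eq snd_merge_sort_short length_finite_permutations_of_set)
  then show ?case using 0 by simp
next
  case (Suc d A)
  let ?P = permutations_of_set
  let ?f = "\<lambda>xs. (5/4 :: real) ^ num_comparisons xs x"
  let ?n = "card A"
  define m where "m = (?n + 1) div 2"
  show ?case
  proof (cases "?n \<le> 1")
    case True
    then have "num_comparisons xs x = 0" if "xs \<in> ?P A" for xs
      using that by (simp add: num_comparisons_eq snd_merge_sort_short length_finite_permutations_of_set)
    then have "(\<Sum>xs\<in>?P A. ?f xs) = fact ?n" using Suc by simp
    also have "\<dots> \<le> 40 ^ Suc d * fact ?n"
      by (subst mult_le_cancel_right1) (auto intro: one_le_power simp del: power_Suc)
    finally show ?thesis .
  next
    case False
    have m: "1 \<le> m" "m < ?n" "m \<le> 2 ^ d" "?n - m \<le> 2 ^ d" "?n - m = ?n div 2" "1 \<le> ?n - m"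
      using False Suc.prems(3) by (auto simp: m_def)
    \<comment> \<open>For fixed \<open>S\<close>, the half containing \<open>x\<close> gives the
      inductive bound and the other half only its number of orders. The product is the same
      whichever half contains \<open>x\<close>.\<close>
    define K :: real where "K = 40 ^ d * (fact m * fact (?n - m))"
    have K: "K \<ge> 0" by (simp add: K_def)
    let ?w = "\<lambda>S. (5/4 :: real) ^ Suc (card (gap S (A - S) x))"
    let ?h = "\<lambda>S. \<Sum>us\<in>?P S. \<Sum>vs\<in>?P (A - S). ?f (us @ vs)"
    have split: "length us = (length (us @ vs) + 1) div 2" "length (us @ vs) > 1" "distinct (us @ vs)"
        "set us = S" "set vs = A - S"
      if "S \<subseteq> A" "card S = m" "us \<in> ?P S" "vs \<in> ?P (A - S)" for S us vs
    proof -
      have "length us = m" "length vs = ?n - m"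
        using that Suc.prems(1)
        by (auto simp: length_finite_permutations_of_set card_Diff_subset finite_subset)
      then have "length us = m" "length (us @ vs) = ?n"
        using m(2) by auto
      then show "length us = (length (us @ vs) + 1) div 2" "length (us @ vs) > 1"
        using False by (simp_all add: m_def)
      show "distinct (us @ vs)" "set us = S" "set vs = A - S"
        using that by (auto simp: permutations_of_set_def)
    qed
    have left: "?h S \<le> K * ?w S" if S: "S \<subseteq> A" "card S = m" "x \<in> S" for S
    proof -
      have finS: "finite S" using S(1) Suc.prems(1) by (rule finite_subset)
      have "?h S \<le> (\<Sum>us\<in>?P S. \<Sum>vs\<in>?P (A - S). ?f us * ?w S)"
      proof (intro sum_mono)
        fix us vs assume "us \<in> ?P S" "vs \<in> ?P (A - S)"
        note sp = split[OF S(1,2) this]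
        have "num_comparisons (us @ vs) x \<le> num_comparisons us x + Suc (card (gap S (A - S) x))"
          using num_comparisons_append(1)[OF sp(1-3), of x] S(3) by (simp add: sp(4,5))
        then have "?f (us @ vs) \<le> (5/4) ^ (num_comparisons us x + Suc (card (gap S (A - S) x)))"
          by (intro power_increasing) auto
        then show "?f (us @ vs) \<le> ?f us * ?w S" by (simp only: power_add)
      qed
      also have "\<dots> = (\<Sum>us\<in>?P S. ?f us) * (fact (?n - m) * ?w S)"
        using S Suc.prems(1) finS
        by (simp add: card_Diff_subset sum_distrib_left sum_distrib_right mult_ac)
      also have "\<dots> \<le> (40 ^ d * fact m) * (fact (?n - m) * ?w S)"
        using Suc.IH[OF finS S(3)] S(2) m by (intro mult_right_mono) auto
      finally show ?thesis by (simp add: K_def mult_ac)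
    qed
    have right: "?h S \<le> K * ?w (A - S)" if S: "S \<subseteq> A" "card S = m" "x \<in> A - S" for S
    proof -
      have finS: "finite S" using S(1) Suc.prems(1) by (rule finite_subset)
      have AS: "A - (A - S) = S" using S(1) by auto
      have "?h S \<le> (\<Sum>us\<in>?P S. \<Sum>vs\<in>?P (A - S). ?f vs * ?w (A - S))"
      proof (intro sum_mono)
        fix us vs assume "us \<in> ?P S" "vs \<in> ?P (A - S)"
        note sp = split[OF S(1,2) this]
        have "num_comparisons (us @ vs) x \<le> num_comparisons vs x + Suc (card (gap (A - S) (A - (A - S)) x))"
          using num_comparisons_append(2)[OF sp(1-3), of x] S(3) unfolding sp(4,5) AS by simp
        then have "?f (us @ vs) \<le> (5/4) ^ (num_comparisons vs x + Suc (card (gap (A - S) (A - (A - S)) x)))"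
          by (intro power_increasing) auto
        then show "?f (us @ vs) \<le> ?f vs * ?w (A - S)" by (simp only: power_add)
      qed
      also have "\<dots> = (\<Sum>vs\<in>?P (A - S). ?f vs) * (fact m * ?w (A - S))"
        using S finS by (simp add: sum_distrib_left sum_distrib_right mult_ac)
      also have "\<dots> \<le> (40 ^ d * fact (?n - m)) * (fact m * ?w (A - S))"
        using Suc.IH[of "A - S"] S m Suc.prems(1) finS
        by (intro mult_right_mono) (auto simp: card_Diff_subset)
      finally show ?thesis by (simp add: K_def mult_ac)
    qed
    have fin: "finite {S. S \<subseteq> A \<and> Q S}" for Q
      using Suc.prems(1) by auto
    have "(\<Sum>xs\<in>?P A. ?f xs) = (\<Sum>S | S \<subseteq> A \<and> card S = m. ?h S)"
      using m Suc.prems(1) by (intro sum_permutations_split) auto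
    also have "{S. S \<subseteq> A \<and> card S = m} =
        {S. S \<subseteq> A \<and> card S = m \<and> x \<in> S} \<union> {S. S \<subseteq> A \<and> card S = m \<and> x \<in> A - S}"
      using Suc.prems(2) by auto
    also have "(\<Sum>S\<in>\<dots>. ?h S) = (\<Sum>S | S \<subseteq> A \<and> card S = m \<and> x \<in> S. ?h S) +
        (\<Sum>S | S \<subseteq> A \<and> card S = m \<and> x \<in> A - S. ?h S)"
      using fin by (intro sum.union_disjoint) auto
    also have "\<dots> \<le> (\<Sum>S | S \<subseteq> A \<and> card S = m \<and> x \<in> S. K * ?w S) +
        (\<Sum>S | S \<subseteq> A \<and> card S = m \<and> x \<in> A - S. K * ?w (A - S))"
      using left right by (intro add_mono sum_mono) auto
    also have "(\<Sum>S | S \<subseteq> A \<and> card S = m \<and> x \<in> A - S. K * ?w (A - S)) =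
        (\<Sum>S | S \<subseteq> A \<and> card S = ?n - m \<and> x \<in> S. K * ?w S)"
      using m(2) Suc.prems(1) by (intro sum_complements) auto
    also have "(\<Sum>S | S \<subseteq> A \<and> card S = m \<and> x \<in> S. K * ?w S) + \<dots> \<le>
        K * (40 * real ((?n - 1) choose (m - 1))) + K * (40 * real ((?n - 1) choose (?n - m - 1)))"
      unfolding sum_distrib_left[symmetric]
      using m Suc.prems(1,2) K
      by (intro add_mono mult_left_mono sum_power_gap) (auto simp: m_def)
    \<comment> \<open>Symmetry prepares Pascal's rule: the cases of \<open>x\<close> left and
      \<open>x\<close> right add up to \<open>?n choose m\<close>, so together they cost a factor 40
      rather than 80.\<close>
    also have "(?n - 1) choose (?n - m - 1) = (?n - 1) choose m"
      using m by (subst binomial_symmetric) (auto intro!: arg_cong2[where f = "(choose)"])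
    also have "K * (40 * real ((?n - 1) choose (m - 1))) + K * (40 * real ((?n - 1) choose m)) =
        40 * K * real (?n choose m)"
      using m choose_reduce_nat[of ?n m] by (simp add: algebra_simps)
    also have "\<dots> = 40 ^ Suc d * real (fact m * fact (?n - m) * (?n choose m))"
      by (simp add: K_def)
    also have "\<dots> = 40 ^ Suc d * fact ?n"
      using m by (subst binomial_fact_lemma) auto
    finally show ?thesis .
  qed
qed

section \<open>Tail bound and union bound\<close>

text \<open>Markov's inequality in counting form. The threshold constant 40 works because
  \<open>(5/4)^40\<close> exceeds 6400; its agreement with the factor per level is a
  coincidence.\<close>

lemma card_many_comparisons:
  fixes A :: "'a::linorder set"
  assumes "finite A" "x \<in> A" "card A \<ge> 2"
  shows "real (card {xs \<in> permutations_of_set A. real (num_comparisons xs x) > 40 * log 2 (card A)})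
    \<le> fact (card A) / (card A)\<^sup>2"
proof -
  define n where "n = card A"
  define l where "l = log 2 (real n)"
  define d where "d = nat \<lceil>l\<rceil>"
  let ?B = "{xs \<in> permutations_of_set A. real (num_comparisons xs x) > 40 * l}"
  have n: "n \<ge> 2" using assms(3) by (simp add: n_def)
  have l: "l \<ge> 1" using n by (simp add: l_def le_log_iff)
  have npow: "2 powr l = real n" using n by (simp add: l_def)
  \<comment> \<open>Rounding up adds less than 1, and \<open>l \<ge> 1\<close>, so \<open>d\<close>
    is at most twice \<open>l\<close>.\<close>
  have dl: "l \<le> real d" "real d \<le> 2 * l" using l unfolding d_def by linarith+
  have "real n \<le> 2 powr real d" unfolding npow[symmetric] using dl by simp
  then have "real n \<le> 2 ^ d" by (simp add: powr_realpow)
  then have nd: "card A \<le> 2 ^ d" unfolding n_def by (simp only: of_nat_le_numeral_power_cancel_iff)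
  have "real (card ?B) * 6400 powr l = (\<Sum>xs\<in>?B. 6400 powr l)" by simp
  also have "\<dots> \<le> (\<Sum>xs\<in>?B. (5/4) ^ num_comparisons xs x)"
  proof (rule sum_mono)
    fix xs assume xs: "xs \<in> ?B"
    \<comment> \<open>\<open>6400 = 40^2 \<cdot> 2^2\<close>: one factor absorbs \<open>40^d \<le> 40^(2l)\<close>, the other yields \<open>n^2\<close>\<close>
    have "6400 powr l \<le> ((5/4) powr 40) powr l"
      using l by (intro powr_mono2) (simp_all add: powr_numeral power_divide)
    also have "\<dots> = (5/4) powr (40 * l)" by (simp only: powr_powr)
    also have "\<dots> \<le> (5/4) powr real (num_comparisons xs x)"
      using xs by (intro powr_mono) auto
    also have "\<dots> = (5/4) ^ num_comparisons xs x" by (simp add: powr_realpow)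
    finally show "6400 powr l \<le> (5/4) ^ num_comparisons xs x" .
  qed
  also have "\<dots> \<le> (\<Sum>xs\<in>permutations_of_set A. (5/4) ^ num_comparisons xs x)"
    by (rule sum_mono2) auto
  also have "\<dots> \<le> 40 ^ d * fact n"
    using sum_power_num_comparisons[OF assms(1,2) nd] by (simp add: n_def)
  also have "(40::real) ^ d = 40 powr real d" by (simp add: powr_realpow)
  also have "40 powr real d * fact n \<le> 40 powr (2 * l) * fact n"
    using dl by (intro mult_right_mono powr_mono) auto
  also have "(40::real) powr (2 * l) = 1600 powr l"
    by (simp add: powr_powr[symmetric] powr_numeral)
  finally have "real (card ?B) * 6400 powr l \<le> 1600 powr l * fact n" .
  moreover have "(6400::real) powr l = 1600 powr l * (real n)\<^sup>2"
  proof -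
    have "(6400::real) powr l = (1600 * (2 * 2)) powr l" by simp
    also have "\<dots> = 1600 powr l * (2 powr l * 2 powr l)" by (simp only: powr_mult)
    finally show ?thesis by (simp add: npow power2_eq_square)
  qed
  ultimately have "1600 powr l * (real (card ?B) * (real n)\<^sup>2) \<le> 1600 powr l * fact n"
    by (simp add: mult_ac)
  then have "real (card ?B) * (real n)\<^sup>2 \<le> fact n"
    by (subst (asm) mult_le_cancel_left_pos) auto
  then show ?thesis using n unfolding n_def[symmetric] l_def[symmetric] by (simp add: field_simps)
qed

theorem theorem35:
  "\<exists>C::real. \<forall>n::nat. \<forall>A::'a::linorder set. n \<ge> 1 \<longrightarrow> finite A \<longrightarrow> card A = n \<longrightarrow>
     measure_pmf.prob (pmf_of_set (permutations_of_set A))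
       {xs. \<forall>x\<in>A. real (num_comparisons xs x) \<le> C * log 2 (real n)} \<ge> 1 - 1 / real n"
proof (intro exI[of _ "40 :: real"] allI impI)
  fix n :: nat and A :: "'a set"
  assume n: "n \<ge> 1" and fin: "finite A" and card: "card A = n"
  let ?P = "permutations_of_set A"
  let ?G = "{xs. \<forall>x\<in>A. real (num_comparisons xs x) \<le> 40 * log 2 (real n)}"
  let ?B = "\<lambda>x. {xs \<in> ?P. real (num_comparisons xs x) > 40 * log 2 (real n)}"
  show "measure_pmf.prob (pmf_of_set ?P) ?G \<ge> 1 - 1 / real n"
  \<comment> \<open>For \<open>n = 1\<close> the required probability is 0; the tail bound needs at
    least two elements.\<close>
  proof (cases "n = 1")
    case False
    \<comment> \<open>Union bound: each of the \<open>n\<close> elements is bad for at most a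
      fraction \<open>1/n^2\<close> of the permutations.\<close>
    have "real (card (?P - ?G)) \<le> real (card (\<Union>x\<in>A. ?B x))"
      using fin by (intro of_nat_mono card_mono) auto
    also have "\<dots> \<le> (\<Sum>x\<in>A. real (card (?B x)))"
      using card_UN_le[OF fin, of ?B] by (simp flip: of_nat_sum)
    also have "\<dots> \<le> (\<Sum>x\<in>A. fact n / (real n)\<^sup>2)"
      using card_many_comparisons[OF fin] n card False by (intro sum_mono) auto
    also have "\<dots> = fact n / real n"
      using card n by (simp add: power2_eq_square)
    finally have bad: "real (card (?P - ?G)) \<le> fact n / real n" .
    have "card ?P = card (?P \<inter> ?G) + card (?P - ?G)"
      by (intro card_Int_Diff) simp
    moreover have "real (card ?P) = fact n"
      using fin card by simp
    ultimately have "fact n = real (card (?P \<inter> ?G)) + real (card (?P - ?G))"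
      by linarith
    moreover have "(1 - 1 / real n) * fact n = fact n - fact n / real n"
      by (simp add: left_diff_distrib)
    ultimately have "(1 - 1 / real n) * fact n \<le> real (card (?P \<inter> ?G))"
      using bad by linarith
    then show ?thesis
      using fin card by (simp add: measure_pmf_of_set pos_le_divide_eq)
  qed simp
qed

end
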